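(* Let $e_1,e_2,e_3$ be three real symmetric $3\times 3$ matrices with zero trace. Then $e_1,e_2,e_3$ form a $T_3$ if and only if $$\operatorname{sign}\det(e_1-e_2)=\operatorname{sign}\det(e_2-e_3)=\operatorname{sign}\det(e_3-e_1)\neq 0.$$
   Context: Two real symmetric $3\times3$ matrices $e,f$ are called compatible if there exist $a,b\in\mathbb{R}^3$ with $e-f=\frac12(a\otimes b+b\otimes a)$; otherwise they are incompatible. For $e,f$ symmetric let $(e,f)=\{\lambda e+(1-\lambda)f : \lambda\in(0,1)\}$. Three real symmetric $3\times 3$ matrices $e_1,e_2,e_3$ with equal trace form a $T_3$ if (1) they are pairwise incompatible, and (2) there exist $e_{1,1}\in(e_2,e_3)$, $e_{2,2}\in(e_3,e_1)$, $e_{3,3}\in(e_1,e_2)$ such that $e_{i,i}$ is compatible with $e_i$ for $i=1,2,3$. *)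

theory Defs
  imports "HOL-Analysis.Analysis"
begin

definition symmetric_matrix :: "real^'n^'n \<Rightarrow> bool" where
  "symmetric_matrix A \<longleftrightarrow> transpose A = A"

definition outer :: "real^'n \<Rightarrow> real^'m \<Rightarrow> real^'m^'n"  (infixl "\<otimes>\<^sub>o" 75) where
  "a \<otimes>\<^sub>o b = (\<chi> i j. a $ i * b $ j)"

definition compatible :: "real^3^3 \<Rightarrow> real^3^3 \<Rightarrow> bool" where
  "compatible e f \<longleftrightarrow> (\<exists>a b. e - f = (1/2) *\<^sub>R (a \<otimes>\<^sub>o b + b \<otimes>\<^sub>o a))"

text \<open>
  This is not the library's \<^const>\<open>open_segment\<close>, which is empty when the
  endpoints coincide: here the segment between \<open>e\<close> and \<open>e\<close> is \<open>{e}\<close>.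
\<close>

definition segment_between :: "real^3^3 \<Rightarrow> real^3^3 \<Rightarrow> (real^3^3) set" where
  "segment_between e f = {l *\<^sub>R e + (1 - l) *\<^sub>R f | l. 0 < l \<and> l < 1}"

definition T3 :: "real^3^3 \<Rightarrow> real^3^3 \<Rightarrow> real^3^3 \<Rightarrow> bool" where
  "T3 e1 e2 e3 \<longleftrightarrow>
     symmetric_matrix e1 \<and> symmetric_matrix e2 \<and> symmetric_matrix e3 \<and>
     trace e1 = trace e2 \<and> trace e2 = trace e3 \<and>
     \<not> compatible e1 e2 \<and> \<not> compatible e2 e3 \<and> \<not> compatible e3 e1 \<and>
     (\<exists>e11 \<in> segment_between e2 e3. \<exists>e22 \<in> segment_between e3 e1. \<exists>e33 \<in> segment_between e1 e2.
        compatible e11 e1 \<and> compatible e22 e2 \<and> compatible e33 e3)"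

end

theory Submission
  imports Defs
begin

text \<open>
  A trace-free symmetric matrix is a symmetrized product of two vectors exactly when it is
  singular (\<open>compatible_iff_det_eq_0\<close>): such a product has rank at most \<open>2\<close>, and conversely an
  eigenvalue \<open>0\<close> makes the others \<open>\<mu>\<close> and \<open>-\<mu>\<close>, so that the quadratic form is a difference of
  two squares and factors. Hence the whole question is about the zeros of \<open>det\<close> on differences.
  With \<open>A = e1 - e2\<close> and \<open>B = e2 - e3\<close>, all of these lie in the plane spanned by \<open>A\<close> and \<open>B\<close>,
  where \<open>det\<close> is a binary cubic form.

  If the three determinants have the same nonzero sign, then along each side of the triangle the
  cubic \<open>det (e\<^sub>i - h)\<close> has opposite signs at the two ends, because \<open>det\<close> is odd; the intermediate
  value theorem gives the point \<open>h\<close> (\<open>ex_singular_in_segment\<close>).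

  Conversely, two of the three nonzero determinants always have the same sign, say those of \<open>A\<close>
  and \<open>B\<close>. Two of the three points of a \<open>T\<^sub>3\<close> then give two zeros of the cubic
  that lie between the directions \<open>A\<close> and \<open>A + B\<close> and between \<open>A + B\<close> and \<open>B\<close>. Each of the two
  linear factors changes sign once on the way from \<open>A\<close> to \<open>B\<close>; since the values at \<open>A\<close> and \<open>B\<close>
  have the same sign, the one remaining linear factor does not. So \<open>det (A + B)\<close>, taken between
  the two zeros, has the sign opposite to \<open>det A\<close> (\<open>binary_cubic_opposite_sign\<close>), and the third
  determinant \<open>det (e3 - e1) = - det (A + B)\<close> agrees with the other two.
\<close>

section \<open>Singular trace-free symmetric matrices\<close>

text \<open>
  Completing the square in the quadratic form with diagonal \<open>x, y, z\<close> and off-diagonal entries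
  \<open>p, q, r\<close> (at positions 12, 13, 23) leaves \<open>1 / x\<close> times a binary form with coefficients
  \<open>- P\<close>, \<open>2 * (x * r - p * q)\<close>, \<open>- Q\<close>. The determinant of the binary form is \<open>x\<close> times
  that of the whole form, hence \<open>0\<close>, so the binary form is a square up to sign. The trace condition makes that sign negative. With
  \<open>\<alpha>\<close>, \<open>\<beta>\<close> as coefficients of the square root, the form is \<open>1 / x\<close> times
  \<open>(x * X + p * Y + q * Z)\<^sup>2 - (\<alpha> * Y + \<beta> * Z)\<^sup>2\<close>.
\<close>

lemma quadratic_form_splits_if_diagonal_nonzero:
  fixes x y z p q r :: real
  assumes x: "x \<noteq> 0" and tr: "x + y + z = 0"
    and det: "x * y * z + 2 * p * q * r - x * r\<^sup>2 - y * q\<^sup>2 - z * p\<^sup>2 = 0"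
  shows "\<exists>a1 a2 a3 b1 b2 b3. a1 * b1 = x \<and> a2 * b2 = y \<and> a3 * b3 = z \<and>
    a1 * b2 + a2 * b1 = 2 * p \<and> a1 * b3 + a3 * b1 = 2 * q \<and> a2 * b3 + a3 * b2 = 2 * r"
proof -
  define P where "P = p\<^sup>2 - x * y"
  define Q where "Q = q\<^sup>2 - x * z"
  have "P * Q - (p * q - x * r)\<^sup>2
      = x * (x * y * z + 2 * p * q * r - x * r\<^sup>2 - y * q\<^sup>2 - z * p\<^sup>2)"
    unfolding P_def Q_def by (simp add: algebra_simps power2_eq_square)
  then have PQ: "P * Q = (p * q - x * r)\<^sup>2"
    using det by simp
  have "P + Q = p\<^sup>2 + q\<^sup>2 + x\<^sup>2 - x * (x + y + z)"
    unfolding P_def Q_def by (simp add: algebra_simps power2_eq_square)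
  then have "P + Q > 0"
    using x tr by (simp add: add_nonneg_pos)
  moreover have "P * Q \<ge> 0"
    unfolding PQ by simp
  ultimately have nonneg: "P \<ge> 0" "Q \<ge> 0"
    by (auto simp: zero_le_mult_iff)
  define s where "s = (if p * q - x * r \<ge> 0 then 1 else -1 :: real)"
  define \<alpha> where "\<alpha> = sqrt P"
  define \<beta> where "\<beta> = s * sqrt Q"
  have s2: "s * s = 1"
    by (simp add: s_def)
  have \<alpha>: "\<alpha> * \<alpha> = p * p - x * y"
    using nonneg by (simp add: \<alpha>_def) (simp add: P_def power2_eq_square)
  have "\<beta> * \<beta> = (s * s) * (sqrt Q * sqrt Q)"
    by (simp add: \<beta>_def)
  then have \<beta>: "\<beta> * \<beta> = q * q - x * z"
    using nonneg s2 by (simp add: Q_def power2_eq_square)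
  have "\<alpha> * \<beta> = s * sqrt (P * Q)"
    by (simp add: \<alpha>_def \<beta>_def real_sqrt_mult)
  then have \<alpha>\<beta>: "\<alpha> * \<beta> = p * q - x * r"
    by (simp add: PQ s_def)
  have "(p + \<alpha>) / x * (p - \<alpha>) = y"
    using x \<alpha> by (simp add: field_simps)
  moreover have "(q + \<beta>) / x * (q - \<beta>) = z"
    using x \<beta> by (simp add: field_simps)
  moreover have "(p + \<alpha>) / x * (q - \<beta>) + (q + \<beta>) / x * (p - \<alpha>) = 2 * r"
  proof -
    have "(p + \<alpha>) / x * (q - \<beta>) + (q + \<beta>) / x * (p - \<alpha>) = 2 * (p * q - \<alpha> * \<beta>) / x"
      by (simp add: algebra_simps diff_divide_distrib add_divide_distrib)
    then show ?thesis
      using x by (simp add: \<alpha>\<beta>)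
  qed
  moreover have "1 * (p - \<alpha>) + (p + \<alpha>) / x * x = 2 * p" "1 * (q - \<beta>) + (q + \<beta>) / x * x = 2 * q"
    using x by simp_all
  moreover have "1 * x = x"
    by simp
  ultimately show ?thesis
    by blast
qed

text \<open>
  If some diagonal entry is nonzero, the previous lemma applies after permuting the variables.
  Otherwise \<open>p * q * r = 0\<close>, and a form such as \<open>2 * q * X * Z + 2 * r * Y * Z\<close> has a variable as
  a factor.
\<close>

lemma quadratic_form_splits:
  fixes x y z p q r :: real
  assumes tr: "x + y + z = 0"
    and det: "x * y * z + 2 * p * q * r - x * r\<^sup>2 - y * q\<^sup>2 - z * p\<^sup>2 = 0"
  shows "\<exists>a1 a2 a3 b1 b2 b3. a1 * b1 = x \<and> a2 * b2 = y \<and> a3 * b3 = z \<and>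
    a1 * b2 + a2 * b1 = 2 * p \<and> a1 * b3 + a3 * b1 = 2 * q \<and> a2 * b3 + a3 * b2 = 2 * r"
proof -
  consider "x \<noteq> 0" | "y \<noteq> 0" | "z \<noteq> 0" | "x = 0" "y = 0" "z = 0"
    by blast
  then show ?thesis
  proof cases
    case 1
    then show ?thesis
      using quadratic_form_splits_if_diagonal_nonzero tr det by blast
  next
    case 2
    have "y + x + z = 0" "y * x * z + 2 * p * r * q - y * q\<^sup>2 - x * r\<^sup>2 - z * p\<^sup>2 = 0"
      using tr det by (simp_all add: algebra_simps)
    from quadratic_form_splits_if_diagonal_nonzero[OF 2 this] obtain a1 a2 a3 b1 b2 b3 where
      "a2 * b2 = y" "a1 * b1 = x" "a3 * b3 = z" "a2 * b1 + a1 * b2 = 2 * p"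
      "a2 * b3 + a3 * b2 = 2 * r" "a1 * b3 + a3 * b1 = 2 * q"
      by blast
    then show ?thesis
      by (intro exI[of _ a1] exI[of _ a2] exI[of _ a3] exI[of _ b1] exI[of _ b2] exI[of _ b3]) simp
  next
    case 3
    have "z + y + x = 0" "z * y * x + 2 * r * q * p - z * p\<^sup>2 - y * q\<^sup>2 - x * r\<^sup>2 = 0"
      using tr det by (simp_all add: algebra_simps)
    from quadratic_form_splits_if_diagonal_nonzero[OF 3 this] obtain a1 a2 a3 b1 b2 b3 where
      "a3 * b3 = z" "a2 * b2 = y" "a1 * b1 = x" "a3 * b2 + a2 * b3 = 2 * r"
      "a3 * b1 + a1 * b3 = 2 * q" "a2 * b1 + a1 * b2 = 2 * p"
      by blast
    then show ?thesis
      by (intro exI[of _ a1] exI[of _ a2] exI[of _ a3] exI[of _ b1] exI[of _ b2] exI[of _ b3]) simp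
  next
    case 4
    then consider "p = 0" | "q = 0" | "r = 0"
      using det by auto
    then show ?thesis
    proof cases
      case 1
      show ?thesis
        by (rule exI[of _ 0], rule exI[of _ 0], rule exI[of _ 1],
            rule exI[of _ "2 * q"], rule exI[of _ "2 * r"], rule exI[of _ 0]) (simp add: 1 4)
    next
      case 2
      show ?thesis
        by (rule exI[of _ 0], rule exI[of _ 1], rule exI[of _ 0],
            rule exI[of _ "2 * p"], rule exI[of _ 0], rule exI[of _ "2 * r"]) (simp add: 2 4)
    next
      case 3
      show ?thesis
        by (rule exI[of _ 1], rule exI[of _ 0], rule exI[of _ 0],
            rule exI[of _ 0], rule exI[of _ "2 * p"], rule exI[of _ "2 * q"]) (simp add: 3 4)
    qed
  qed
qed

lemma det_symmetrized_outer:
  fixes a b :: "real^3"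
  shows "det ((1/2) *\<^sub>R (a \<otimes>\<^sub>o b + b \<otimes>\<^sub>o a)) = 0"
  by (simp add: det_3 outer_def algebra_simps)

lemma ex_symmetrized_outer_if_det_eq_0:
  fixes M :: "real^3^3"
  assumes sym: "symmetric_matrix M" and tr: "trace M = 0" and det: "det M = 0"
  shows "\<exists>a b. M = (1/2) *\<^sub>R (a \<otimes>\<^sub>o b + b \<otimes>\<^sub>o a)"
proof -
  have sym': "M $ j $ i = M $ i $ j" for i j
  proof -
    have "transpose M $ i $ j = M $ i $ j"
      using sym by (simp add: symmetric_matrix_def)
    then show ?thesis
      by (simp add: transpose_def)
  qed
  have "M$1$1 + M$2$2 + M$3$3 = 0"
    using tr by (simp add: trace_def sum_3)
  moreover have "M$1$1 * M$2$2 * M$3$3 + 2 * M$1$2 * M$1$3 * M$2$3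
      - M$1$1 * (M$2$3)\<^sup>2 - M$2$2 * (M$1$3)\<^sup>2 - M$3$3 * (M$1$2)\<^sup>2 = 0"
    using det unfolding det_3 sym'[of 1 2] sym'[of 1 3] sym'[of 2 3]
    by (simp add: algebra_simps power2_eq_square)
  ultimately obtain a1 a2 a3 b1 b2 b3 where
    "a1 * b1 = M$1$1" "a2 * b2 = M$2$2" "a3 * b3 = M$3$3"
    "a1 * b2 + a2 * b1 = 2 * M$1$2" "a1 * b3 + a3 * b1 = 2 * M$1$3"
    "a2 * b3 + a3 * b2 = 2 * M$2$3"
    using quadratic_form_splits by blast
  then have "M = (1/2) *\<^sub>R (vector [a1, a2, a3] \<otimes>\<^sub>o vector [b1, b2, b3]
      + vector [b1, b2, b3] \<otimes>\<^sub>o vector [a1, a2, a3])"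
    using sym'[of 1 2] sym'[of 1 3] sym'[of 2 3]
    by (simp add: vec_eq_iff forall_3 outer_def algebra_simps)
  then show ?thesis
    by blast
qed

lemma compatible_iff_det_eq_0:
  assumes "symmetric_matrix e" "symmetric_matrix f" "trace e = 0" "trace f = 0"
  shows "compatible e f \<longleftrightarrow> det (e - f) = 0"
proof -
  have "symmetric_matrix (e - f)" "trace (e - f) = 0"
    using assms by (auto simp: symmetric_matrix_def transpose_def vec_eq_iff trace_def sum_subtractf)
  then show ?thesis
    unfolding compatible_def
    using ex_symmetrized_outer_if_det_eq_0 det_symmetrized_outer by metis
qed

section \<open>The determinant along the sides of the triangle\<close>

lemma det_diff_swap:
  fixes e f :: "real^3^3"
  shows "det (f - e) = - det (e - f)"
  by (simp add: det_3 algebra_simps)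

lemma symmetric_tracefree_segment:
  assumes "h \<in> segment_between e f"
    and "symmetric_matrix e" "symmetric_matrix f" "trace e = 0" "trace f = 0"
  shows "symmetric_matrix h" "trace h = 0"
  using assms
  by (auto simp: segment_between_def symmetric_matrix_def transpose_def vec_eq_iff trace_def
      sum.distrib simp flip: sum_distrib_left)

lemma ex_singular_in_segment:
  fixes e f g :: "real^3^3"
  assumes "det (e - f) * det (e - g) < 0"
  shows "\<exists>h \<in> segment_between f g. det (h - e) = 0"
proof -
  define D where "D l = det (e - (l *\<^sub>R f + (1 - l) *\<^sub>R g))" for l :: real
  have cont: "continuous_on {0..1} D" "continuous_on {0..1} (\<lambda>l. - D l)"
    unfolding D_def det_3 by (auto intro!: continuous_intros)
  have ends: "D 1 = det (e - f)" "D 0 = det (e - g)"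
    by (simp_all add: D_def)
  have "\<exists>l. 0 \<le> l \<and> l \<le> 1 \<and> D l = 0"
  proof (cases "D 0 < 0")
    case True
    then show ?thesis
      using assms ends IVT'[of D 0 0 1] cont by (auto simp: mult_less_0_iff)
  next
    case False
    then show ?thesis
      using assms ends IVT'[of "\<lambda>l. - D l" 0 0 1] cont by (auto simp: mult_less_0_iff)
  qed
  then obtain l where l: "0 \<le> l" "l \<le> 1" "D l = 0"
    by blast
  then have "l \<noteq> 0" "l \<noteq> 1"
    using assms ends by auto
  with l have "l *\<^sub>R f + (1 - l) *\<^sub>R g \<in> segment_between f g"
    by (auto simp: segment_between_def)
  moreover have "det (l *\<^sub>R f + (1 - l) *\<^sub>R g - e) = 0"
    using l by (metis D_def det_diff_swap neg_equal_0_iff_equal)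
  ultimately show ?thesis
    by blast
qed

section \<open>Zeros of the binary cubic form\<close>

lemma det_binary_cubic:
  fixes A B :: "real^3^3"
  shows "\<exists>b c. \<forall>s t. det (s *\<^sub>R A + t *\<^sub>R B)
    = det A * s^3 + b * s\<^sup>2 * t + c * s * t\<^sup>2 + det B * t^3"
proof -
  \<comment> \<open>By multilinearity in the rows, the coefficient of \<open>s\<^sup>2 * t\<close> sums the determinants of \<open>A\<close>
    with one row taken from \<open>B\<close>; exchanging the matrices gives that of \<open>s * t\<^sup>2\<close>.\<close>
  define mixed :: "real^3^3 \<Rightarrow> real^3^3 \<Rightarrow> real" where
    "mixed X Y = (\<Sum>k\<in>UNIV. det (\<chi> i. if i = k then Y $ i else X $ i))" for X Y
  have "det (s *\<^sub>R A + t *\<^sub>R B)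
      = det A * s^3 + mixed A B * s\<^sup>2 * t + mixed B A * s * t\<^sup>2 + det B * t^3" for s t
    unfolding mixed_def sum_3 det_3
    by (simp add: algebra_simps power2_eq_square power3_eq_cube)
  then show ?thesis
    by blast
qed

text \<open>
  For the form \<open>a * s\<^sup>3 + b * s\<^sup>2 * t + c * s * t\<^sup>2 + d * t\<^sup>3\<close>,
  the zeros \<open>(1, u)\<close> and \<open>(v, 1)\<close> split off two linear factors, and comparing the coefficients of
  \<open>s\<^sup>3\<close> and \<open>t\<^sup>3\<close> gives the third: the form is
  \<open>(t - u * s) * (s - v * t) * (- (a / u) * s - (d / v) * t)\<close>. The sign of its value at \<open>(1, 1)\<close>
  is that of \<open>- (a / u + d / v)\<close>, and \<open>a\<close> and \<open>d\<close> have the same sign.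
\<close>

lemma binary_cubic_opposite_sign:
  fixes a b c d u v :: real
  assumes u: "0 < u" "u < 1" and v: "0 < v" "v < 1"
    and zero1: "a + b * u + c * u\<^sup>2 + d * u^3 = 0"
    and zero2: "a * v^3 + b * v\<^sup>2 + c * v + d = 0"
    and ad: "a * d > 0"
  shows "a * (a + b + c + d) < 0"
proof -
  have "u * v < 1"
    using u v mult_strict_mono[of u 1 v 1] by simp
  \<comment> \<open>The two equations are solved for \<open>b\<close> and \<open>c\<close>; their determinant is \<open>u * v * (1 - u * v)\<close>.\<close>
  have "(1 - u * v) * (u * v * (a + b + c + d) + (1 - u) * (1 - v) * (a * v + d * u))
      = (v - v\<^sup>2) * (a + b * u + c * u\<^sup>2 + d * u^3) + (u - u\<^sup>2) * (a * v^3 + b * v\<^sup>2 + c * v + d)"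
    by (simp add: algebra_simps power2_eq_square power3_eq_cube)
  then have "u * v * (a + b + c + d) = - ((1 - u) * (1 - v) * (a * v + d * u))"
    using zero1 zero2 \<open>u * v < 1\<close> by simp
  then have "a * (u * v * (a + b + c + d)) = - (a * ((1 - u) * (1 - v) * (a * v + d * u)))"
    by simp
  then have "u * v * (a * (a + b + c + d)) = - ((1 - u) * (1 - v) * (a * a * v + a * d * u))"
    by (simp only: mult_ac distrib_left)
  moreover have "a * a * v + a * d * u > 0"
    using ad u v by (intro add_nonneg_pos) auto
  ultimately have "u * v * (a * (a + b + c + d)) < 0"
    using u v by simp
  then show ?thesis
    using u v by (simp add: mult_less_0_iff zero_less_mult_iff)
qed

text \<open>
  The points \<open>h1\<close> and \<open>h3\<close> lie on the two sides that meet in \<open>e2\<close>, so \<open>e1 - h1\<close> and \<open>h3 - e3\<close>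
  are combinations of \<open>e1 - e2\<close> and \<open>e2 - e3\<close> with nonnegative coefficients, on either side of their
  sum \<open>e1 - e3\<close>.
\<close>

lemma det_same_sign_third_side:
  fixes e1 e2 e3 :: "real^3^3"
  assumes h1: "h1 \<in> segment_between e2 e3" "det (h1 - e1) = 0"
    and h3: "h3 \<in> segment_between e1 e2" "det (h3 - e3) = 0"
    and same: "det (e1 - e2) * det (e2 - e3) > 0"
  shows "det (e1 - e2) * det (e3 - e1) > 0"
proof -
  obtain b c where cubic: "\<And>s t. det (s *\<^sub>R (e1 - e2) + t *\<^sub>R (e2 - e3))
      = det (e1 - e2) * s^3 + b * s\<^sup>2 * t + c * s * t\<^sup>2 + det (e2 - e3) * t^3"
    using det_binary_cubic by blast
  obtain l where l: "0 < l" "l < 1" "h1 = l *\<^sub>R e2 + (1 - l) *\<^sub>R e3"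
    using h1(1) by (auto simp: segment_between_def)
  obtain m where m: "0 < m" "m < 1" "h3 = m *\<^sub>R e1 + (1 - m) *\<^sub>R e2"
    using h3(1) by (auto simp: segment_between_def)
  have "e1 - h1 = 1 *\<^sub>R (e1 - e2) + (1 - l) *\<^sub>R (e2 - e3)"
    unfolding l(3) by (simp add: algebra_simps)
  then have zero1: "det (1 *\<^sub>R (e1 - e2) + (1 - l) *\<^sub>R (e2 - e3)) = 0"
    using h1(2) det_diff_swap[of e1 h1] by (metis neg_equal_0_iff_equal)
  have "h3 - e3 = m *\<^sub>R (e1 - e2) + 1 *\<^sub>R (e2 - e3)"
    unfolding m(3) by (simp add: algebra_simps)
  then have zero2: "det (m *\<^sub>R (e1 - e2) + 1 *\<^sub>R (e2 - e3)) = 0"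
    using h3(2) by metis
  have "1 *\<^sub>R (e1 - e2) + 1 *\<^sub>R (e2 - e3) = e1 - e3"
    by simp
  then have sum: "det (e1 - e3) = det (e1 - e2) + b + c + det (e2 - e3)"
    using cubic[of 1 1] by simp
  have "det (e1 - e2) * (det (e1 - e2) + b + c + det (e2 - e3)) < 0"
    using l m same zero1 zero2 cubic[of 1 "1 - l"] cubic[of m 1]
    by (intro binary_cubic_opposite_sign[of "1 - l" m]) auto
  then have "det (e1 - e2) * det (e1 - e3) < 0"
    by (simp only: sum)
  then show ?thesis
    by (simp add: det_diff_swap[of e1 e3])
qed

section \<open>The characterization of \<open>T\<^sub>3\<close>\<close>

theorem lemma4p3:
  fixes e1 e2 e3 :: "real^3^3"
  assumes "symmetric_matrix e1" "symmetric_matrix e2" "symmetric_matrix e3"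
    and "trace e1 = 0" "trace e2 = 0" "trace e3 = 0"
  shows "T3 e1 e2 e3 \<longleftrightarrow>
    sgn (det (e1 - e2)) = sgn (det (e2 - e3)) \<and>
    sgn (det (e2 - e3)) = sgn (det (e3 - e1)) \<and>
    sgn (det (e3 - e1)) \<noteq> 0"
proof -
  note compat = compatible_iff_det_eq_0 symmetric_tracefree_segment
  define a where "a = det (e1 - e2)"
  define b where "b = det (e2 - e3)"
  define c where "c = det (e3 - e1)"
  have T3: "T3 e1 e2 e3 \<longleftrightarrow> a \<noteq> 0 \<and> b \<noteq> 0 \<and> c \<noteq> 0 \<and>
      (\<exists>h \<in> segment_between e2 e3. det (h - e1) = 0) \<and>
      (\<exists>h \<in> segment_between e3 e1. det (h - e2) = 0) \<and>
      (\<exists>h \<in> segment_between e1 e2. det (h - e3) = 0)"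
  proof -
    have "compatible h e1 \<longleftrightarrow> det (h - e1) = 0" if "h \<in> segment_between e2 e3" for h
      using compat that assms by blast
    moreover have "compatible h e2 \<longleftrightarrow> det (h - e2) = 0" if "h \<in> segment_between e3 e1" for h
      using compat that assms by blast
    moreover have "compatible h e3 \<longleftrightarrow> det (h - e3) = 0" if "h \<in> segment_between e1 e2" for h
      using compat that assms by blast
    ultimately show ?thesis
      unfolding T3_def a_def b_def c_def using assms by (simp add: compatible_iff_det_eq_0)
  qed
  have "T3 e1 e2 e3 \<longleftrightarrow> a * b > 0 \<and> b * c > 0 \<and> c * a > 0"
  proof
    assume "T3 e1 e2 e3"
    then obtain h1 h2 h3 where nz: "a \<noteq> 0" "b \<noteq> 0" "c \<noteq> 0"
      and h1: "h1 \<in> segment_between e2 e3" "det (h1 - e1) = 0"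
      and h2: "h2 \<in> segment_between e3 e1" "det (h2 - e2) = 0"
      and h3: "h3 \<in> segment_between e1 e2" "det (h3 - e3) = 0"
      unfolding T3 by blast
    have "a * b > 0 \<Longrightarrow> a * c > 0" "b * c > 0 \<Longrightarrow> b * a > 0" "c * a > 0 \<Longrightarrow> c * b > 0"
      unfolding a_def b_def c_def
      using det_same_sign_third_side[OF h1 h3] det_same_sign_third_side[OF h2 h1]
        det_same_sign_third_side[OF h3 h2] by blast+
    then show "a * b > 0 \<and> b * c > 0 \<and> c * a > 0"
      using nz by (auto simp: zero_less_mult_iff neq_iff)
  next
    assume pos: "a * b > 0 \<and> b * c > 0 \<and> c * a > 0"
    have "det (e1 - e2) * det (e1 - e3) < 0" "det (e2 - e3) * det (e2 - e1) < 0"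
      "det (e3 - e1) * det (e3 - e2) < 0"
      using pos det_diff_swap[of e3 e1] det_diff_swap[of e1 e2] det_diff_swap[of e2 e3]
      by (simp_all add: a_def b_def c_def mult.commute)
    then show "T3 e1 e2 e3"
      unfolding T3 using pos ex_singular_in_segment by auto
  qed
  also have "\<dots> \<longleftrightarrow> sgn a = sgn b \<and> sgn b = sgn c \<and> sgn c \<noteq> 0"
    by (auto simp: sgn_if zero_less_mult_iff split: if_splits)
  finally show ?thesis
    unfolding a_def b_def c_def .
qed

end
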